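(* Let $V$ be a real vector space and let $\mathcal{S}_V=\{S:V\to\mathbb{R}\;;\;S\text{ is sub-linear on }V\}$. Then $(\mathcal{S}_V,+,\cdot)$ is a semi-vector space over $\mathbb{R}_0^+$, where $+$ is pointwise addition and $\cdot$ is pointwise multiplication by scalars in $\mathbb{R}_0^+$.
   Context: $\mathbb{R}_0^+=[0,\infty)$. A sub-linear functional on a real vector space $V$ is a function $t:V\to\mathbb{R}$ with $t(u+v)\le t(u)+t(v)$ for all $u,v\in V$ and $t(\alpha v)=\alpha t(v)$ for all $\alpha\in\mathbb{R}_0^+$, $v\in V$. A semi-vector space over $\mathbb{R}_0^+$ is a set $S$ with operations $+:S\times S\to S$ and $\cdot:\mathbb{R}_0^+\times S\to S$ such that: (1) $(S,+)$ is an abelian monoid satisfying the cancellation law $u+v=u+w\Rightarrow v=w$; (2) $\alpha(u+v)=\alpha u+\alpha v$; (3) $(\alpha+\beta)v=\alpha v+\beta v$; (4) $(\alpha\beta)v=\alpha(\beta v)$; (5) $1v=v$. *)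

theory Defs
  imports Complex_Main "HOL-Algebra.Group"
begin

definition sublinear :: "('v::real_vector \<Rightarrow> real) \<Rightarrow> bool" where
  "sublinear t \<longleftrightarrow>
     (\<forall>u v. t (u + v) \<le> t u + t v) \<and>
     (\<forall>\<alpha>\<ge>0. \<forall>v. t (\<alpha> *\<^sub>R v) = \<alpha> * t v)"

definition sublinear_functionals :: "('v::real_vector \<Rightarrow> real) set" where
  "sublinear_functionals = {t. sublinear t}"

text \<open>
  A semi-vector space over the non-negative reals is given by a carrier, an addition and a scalar
  multiplication.  Scalars have type \<^typ>\<open>real\<close>; the values of the scalar multiplication at
  negative scalars, and of both operations off the carrier, are irrelevant.
  As in a monoid \<open>(S, +)\<close>, the neutral element is not part of the data but asserted to exist.
\<close>

locale semi_vector_space =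
  fixes S :: "'a set"
    and add :: "'a \<Rightarrow> 'a \<Rightarrow> 'a"
    and smult :: "real \<Rightarrow> 'a \<Rightarrow> 'a"
  assumes add_comm_monoid: "\<exists>z. comm_monoid \<lparr>carrier = S, mult = add, one = z\<rparr>"
    and add_left_cancel:
      "\<lbrakk>u \<in> S; v \<in> S; w \<in> S; add u v = add u w\<rbrakk> \<Longrightarrow> v = w"
    and smult_closed: "\<lbrakk>0 \<le> \<alpha>; v \<in> S\<rbrakk> \<Longrightarrow> smult \<alpha> v \<in> S"
    and smult_add_right:
      "\<lbrakk>0 \<le> \<alpha>; u \<in> S; v \<in> S\<rbrakk> \<Longrightarrow> smult \<alpha> (add u v) = add (smult \<alpha> u) (smult \<alpha> v)"
    and smult_add_left:
      "\<lbrakk>0 \<le> \<alpha>; 0 \<le> \<beta>; v \<in> S\<rbrakk> \<Longrightarrow> smult (\<alpha> + \<beta>) v = add (smult \<alpha> v) (smult \<beta> v)"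
    and smult_smult:
      "\<lbrakk>0 \<le> \<alpha>; 0 \<le> \<beta>; v \<in> S\<rbrakk> \<Longrightarrow> smult (\<alpha> * \<beta>) v = smult \<alpha> (smult \<beta> v)"
    and smult_one: "v \<in> S \<Longrightarrow> smult 1 v = v"

end

theory Submission
  imports Defs
begin

text \<open>All real-valued functions on V form a real vector space under pointwise operations, so
  cancellation and the equational axioms hold at each point because they hold for real numbers. What
  remains is that the sub-linear functionals form a convex cone in that space: it contains zero
  (\<open>sublinear_zero\<close>) and is closed under sums (\<open>sublinear_add\<close>) and
  nonnegative multiples (\<open>sublinear_cmult\<close>).\<close>

lemma sublinearI:
  assumes "\<And>u v. t (u + v) \<le> t u + t v"
    and "\<And>\<alpha> v. 0 \<le> \<alpha> \<Longrightarrow> t (\<alpha> *\<^sub>R v) = \<alpha> * t v"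
  shows "sublinear t"
  using assms by (simp add: sublinear_def)

lemma sublinear_triangle: "sublinear t \<Longrightarrow> t (u + v) \<le> t u + t v"
  by (simp add: sublinear_def)

lemma sublinear_scaleR: "sublinear t \<Longrightarrow> 0 \<le> \<alpha> \<Longrightarrow> t (\<alpha> *\<^sub>R v) = \<alpha> * t v"
  by (simp add: sublinear_def)

lemma sublinear_zero: "sublinear (\<lambda>v. 0)"
  by (simp add: sublinear_def)

lemma sublinear_add:
  assumes s: "sublinear s" and t: "sublinear t"
  shows "sublinear (\<lambda>v. s v + t v)"
proof (rule sublinearI)
  fix u v
  show "s (u + v) + t (u + v) \<le> s u + t u + (s v + t v)"
    using sublinear_triangle[OF s, of u v] sublinear_triangle[OF t, of u v] by linarith
next
  fix \<alpha> :: real and v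
  assume "0 \<le> \<alpha>"
  then show "s (\<alpha> *\<^sub>R v) + t (\<alpha> *\<^sub>R v) = \<alpha> * (s v + t v)"
    by (simp add: sublinear_scaleR s t distrib_left)
qed

text \<open>Multiplying the subadditivity inequality by a nonnegative \<open>c\<close> preserves its
  direction; a negative factor would reverse it, which is why the scalars are restricted.
  Homogeneity follows by commuting real factors.\<close>

lemma sublinear_cmult:
  assumes t: "sublinear t" and c: "0 \<le> c"
  shows "sublinear (\<lambda>v. c * t v)"
proof (rule sublinearI)
  fix u v
  show "c * t (u + v) \<le> c * t u + c * t v"
    using mult_left_mono[OF sublinear_triangle[OF t] c] by (simp add: distrib_left)
next
  fix \<alpha> :: real and v
  assume "0 \<le> \<alpha>"
  then show "c * t (\<alpha> *\<^sub>R v) = \<alpha> * (c * t v)"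
    by (simp add: sublinear_scaleR t)
qed

text \<open>Provides the zero functional as witness for the neutral element, which the locale only
  asserts to exist.\<close>

lemma comm_monoid_sublinear_functionals:
  "comm_monoid \<lparr>carrier = sublinear_functionals, mult = (\<lambda>s t v. s v + t v), one = (\<lambda>v. 0)\<rparr>"
  by (rule comm_monoidI)
    (simp_all add: sublinear_functionals_def sublinear_add sublinear_zero ac_simps)

theorem theorem3p14:
  shows "semi_vector_space
           (sublinear_functionals :: ('v::real_vector \<Rightarrow> real) set)
           (\<lambda>s t v. s v + t v)
           (\<lambda>\<alpha> t v. \<alpha> * t v)"
proof
  show "\<exists>z. comm_monoid \<lparr>carrier = sublinear_functionals :: ('v \<Rightarrow> real) set,
                        mult = (\<lambda>s t v. s v + t v), one = z\<rparr>"
    using comm_monoid_sublinear_functionals by blast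
\<comment> \<open>Apart from closure under scalars, \<open>fun_eq_iff\<close> turns each remaining
  axiom, cancellation included, into a statement about real numbers at every point.\<close>
qed (auto simp: sublinear_functionals_def sublinear_cmult fun_eq_iff algebra_simps)

end
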